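(* Let $\psi:\mathbb{R}^d\to[0,\infty)$ be a bounded measurable function supported in the unit ball of $\mathbb{R}^d$, let $A$ be an invertible real $d\times d$ matrix, $a(x)=Ax$, and let $K(x,y)=\psi(y-Ax)+\psi(x-Ay)$ for $x,y\in\mathbb{R}^d$. Then $$\lambda_1(\mathbb{R}^d)=\lim_{R\to\infty}\lambda_1(B_R)=2\big(1-|\det(A)|^{-1/2}\big)^2\int_{\mathbb{R}^d}\psi(x)\,dx.$$
   Context: $B_R$ is the ball in $\mathbb{R}^d$ of radius $R$ centered at the origin. For a bounded domain $\Omega\subset\mathbb{R}^d$, the first eigenvalue associated with the kernel $K$ is given by $$\lambda_1(\Omega)=\inf_{u\in L^2(\Omega),\,u\neq 0}\frac{\int_{\mathbb{R}^d}\int_{\mathbb{R}^d}K(x,y)(\tilde u(x)-\tilde u(y))^2\,dx\,dy}{\int_\Omega u^2(x)\,dx},$$ where $\tilde u$ is the extension of $u$ by zero to $\mathbb{R}^d$. For the whole space, $$\lambda_1(\mathbb{R}^d)=\inf_{u\in L^2(\mathbb{R}^d),\,u\neq 0}\frac{\int_{\mathbb{R}^d}\int_{\mathbb{R}^d}K(x,y)(u(x)-u(y))^2\,dx\,dy}{\int_{\mathbb{R}^d}u^2(x)\,dx}.$$ Functions are real valued. *)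

theory Defs
  imports "HOL-Analysis.Analysis"
begin

(* Representatives of the nonzero elements of the real Hilbert space L^2(Omega); only the values
   on Omega matter. Elements of L^2 are classes modulo a.e. equality, so "nonzero" means
   "not a.e. zero on Omega". *)
definition L2_nonzero :: "'a::euclidean_space set \<Rightarrow> ('a \<Rightarrow> real) set" where
  "L2_nonzero \<Omega> =
    {u. u \<in> borel_measurable (lebesgue_on \<Omega>) \<and> integrable (lebesgue_on \<Omega>) (\<lambda>x. (u x)\<^sup>2)
        \<and> \<not> (AE x in lebesgue_on \<Omega>. u x = 0)}"

definition zero_ext :: "'a set \<Rightarrow> ('a \<Rightarrow> real) \<Rightarrow> 'a \<Rightarrow> real" where
  "zero_ext \<Omega> u x = (if x \<in> \<Omega> then u x else 0)"

(* Meant for nonnegative kernels K: the integrals are then integrals of nonnegative functions,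
   taken in [0,\<infinity>]. The denominator is a positive real for every u in L2_nonzero \<Omega>. *)
definition lambda1 :: "('a::euclidean_space \<Rightarrow> 'a \<Rightarrow> real) \<Rightarrow> 'a set \<Rightarrow> ennreal" where
  "lambda1 K \<Omega> =
    (INF u \<in> L2_nonzero \<Omega>.
      (\<integral>\<^sup>+y. (\<integral>\<^sup>+x. ennreal (K x y * (zero_ext \<Omega> u x - zero_ext \<Omega> u y)\<^sup>2) \<partial>lebesgue) \<partial>lebesgue)
      / (\<integral>\<^sup>+x. ennreal ((u x)\<^sup>2) \<partial>lebesgue_on \<Omega>))"

lemma lambda1_UNIV:
  "lambda1 K UNIV =
    (INF u \<in> {u. u \<in> borel_measurable lebesgue \<and> integrable lebesgue (\<lambda>x. (u x)\<^sup>2)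
                 \<and> \<not> (AE x in lebesgue. u x = 0)}.
      (\<integral>\<^sup>+y. (\<integral>\<^sup>+x. ennreal (K x y * (u x - u y)\<^sup>2) \<partial>lebesgue) \<partial>lebesgue)
      / (\<integral>\<^sup>+x. ennreal ((u x)\<^sup>2) \<partial>lebesgue))"
  unfolding lambda1_def L2_nonzero_def zero_ext_def lebesgue_on_UNIV_eq by simp

definition jump_kernel :: "(real^'n \<Rightarrow> real) \<Rightarrow> real^'n^'n \<Rightarrow> real^'n \<Rightarrow> real^'n \<Rightarrow> real" where
  "jump_kernel \<psi> A x y = \<psi> (y - A *v x) + \<psi> (x - A *v y)"

end

theory Submission
  imports Defs
begin

text \<open>
  Put \<open>s = \<bar>det A\<bar>\<^sup>-\<^sup>1\<^sup>/\<^sup>2\<close>. Substituting \<open>y = A x + z\<close>, the energy of \<open>u\<close> is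
  \<open>2 \<integral> \<psi>(z) \<parallel>u - u \<circ> (A + z)\<parallel>\<^sup>2 dz\<close>, and since \<open>u \<circ> (A + z)\<close> has norm \<open>s \<parallel>u\<parallel>\<close>,
  \<open>\<parallel>u - u \<circ> (A + z)\<parallel>\<^sup>2 = (1 - s)\<^sup>2 \<parallel>u\<parallel>\<^sup>2 + s \<parallel>u - u \<circ> (A + z) / s\<parallel>\<^sup>2\<close>.
  This gives the lower bound on every domain. It is asymptotically attained by a compactly supported \<open>u\<close>
  almost invariant under all the isometries \<open>u \<mapsto> u \<circ> (A + z) / s\<close> with \<open>\<bar>z\<bar> \<le> 1\<close>, namely
  \<open>u = \<Sum>k<N. (\<phi> \<circ> A\<^sup>k) / s\<^sup>k\<close> where \<open>\<phi> \<ge> 0\<close> is a bump so wide that the translations by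
  \<open>A\<^sup>k z\<close>, \<open>k < N\<close>, hardly change it: positivity makes \<open>\<parallel>u\<parallel>\<^sup>2 \<ge> N \<parallel>\<phi>\<parallel>\<^sup>2\<close>,
  whereas telescoping bounds \<open>\<parallel>u - u \<circ> (A + z) / s\<parallel>\<^sup>2\<close> by \<open>9 \<parallel>\<phi>\<parallel>\<^sup>2\<close>.
\<close>

subsection \<open>Lebesgue measure under linear maps\<close>

lemma nn_integral_lborel_translate:
  fixes f :: "'a::euclidean_space \<Rightarrow> ennreal"
  assumes [measurable]: "f \<in> borel_measurable borel"
  shows "(\<integral>\<^sup>+x. f (x + z) \<partial>lborel) = (\<integral>\<^sup>+x. f x \<partial>lborel)"
proof -
  have "(\<integral>\<^sup>+x. f x \<partial>lborel) = (\<integral>\<^sup>+x. f x \<partial>distr lborel borel ((+) z))"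
    by (simp add: lborel_distr_plus)
  then show ?thesis
    by (simp add: nn_integral_distr add.commute)
qed

text \<open>Along lines in direction \<open>b\<close> the shear is a translation by
  \<open>x \<bullet> c\<close>, which is constant on such a line because \<open>b\<close> and
  \<open>c\<close> are orthogonal. Integrating first in the \<open>b\<close> coordinate reduces the
  claim to translation invariance.\<close>

lemma nn_integral_lborel_shear:
  fixes f :: "'a::euclidean_space \<Rightarrow> ennreal"
  assumes b: "b \<in> Basis" and c: "c \<in> Basis" and "b \<noteq> c"
    and [measurable]: "f \<in> borel_measurable borel"
  shows "(\<integral>\<^sup>+x. f (x + (x \<bullet> c) *\<^sub>R b) \<partial>lborel) = (\<integral>\<^sup>+x. f x \<partial>lborel)"
proof -
  interpret product_sigma_finite "\<lambda>_::'a. lborel :: real measure"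
    by standard
  let ?B = "Basis - {b}" and ?S = "\<lambda>y. \<Sum>i\<in>Basis - {b}. y i *\<^sub>R i"
  have B: "(Basis::'a set) = insert b ?B"
    using b by auto
  have iterated: "(\<integral>\<^sup>+x. h x \<partial>lborel) =
      (\<integral>\<^sup>+y. (\<integral>\<^sup>+t. h (?S y + t *\<^sub>R b) \<partial>lborel) \<partial>(\<Pi>\<^sub>M i\<in>?B. lborel))"
    if [measurable]: "h \<in> borel_measurable borel" for h :: "'a \<Rightarrow> ennreal"
  proof -
    have "(\<integral>\<^sup>+x. h x \<partial>lborel) = (\<integral>\<^sup>+y. h (\<Sum>i\<in>Basis. y i *\<^sub>R i) \<partial>(\<Pi>\<^sub>M i\<in>Basis. lborel))"
      by (subst lborel_eq) (simp add: nn_integral_distr)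
    also have "\<dots> = (\<integral>\<^sup>+y. h (\<Sum>i\<in>insert b ?B. y i *\<^sub>R i) \<partial>(\<Pi>\<^sub>M i\<in>insert b ?B. lborel))"
      by (simp only: B[symmetric])
    also have "\<dots> = (\<integral>\<^sup>+y. (\<integral>\<^sup>+t. h (\<Sum>i\<in>insert b ?B. (y(b := t)) i *\<^sub>R i) \<partial>lborel) \<partial>(\<Pi>\<^sub>M i\<in>?B. lborel))"
      by (rule product_nn_integral_insert) auto
    also have "\<dots> = (\<integral>\<^sup>+y. (\<integral>\<^sup>+t. h (?S y + t *\<^sub>R b) \<partial>lborel) \<partial>(\<Pi>\<^sub>M i\<in>?B. lborel))"
    proof -
      have "(\<Sum>i\<in>insert b ?B. (y(b := t)) i *\<^sub>R i) = ?S y + t *\<^sub>R b" for y t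
        by (subst sum.insert) (auto intro!: sum.cong)
      then show ?thesis
        by (simp only:)
    qed
    finally show ?thesis .
  qed
  have "?S y \<bullet> c = y c" for y
  proof -
    have "?S y \<bullet> c = (\<Sum>i\<in>?B. y i * (if i = c then 1 else 0))"
      using c by (auto simp: inner_sum_left inner_Basis intro!: sum.cong)
    also have "\<dots> = y c"
      using c \<open>b \<noteq> c\<close> by (simp add: if_distrib sum.delta cong: if_cong)
    finally show ?thesis .
  qed
  moreover have "b \<bullet> c = 0"
    using b c \<open>b \<noteq> c\<close> by (simp add: inner_Basis)
  ultimately have "(\<integral>\<^sup>+x. f (x + (x \<bullet> c) *\<^sub>R b) \<partial>lborel) =
      (\<integral>\<^sup>+y. (\<integral>\<^sup>+t. f (?S y + (t + y c) *\<^sub>R b) \<partial>lborel) \<partial>(\<Pi>\<^sub>M i\<in>?B. lborel))"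
    by (subst iterated) (simp_all add: inner_add_left scaleR_add_left add.assoc)
  also have "\<dots> = (\<integral>\<^sup>+y. (\<integral>\<^sup>+t. f (?S y + t *\<^sub>R b) \<partial>lborel) \<partial>(\<Pi>\<^sub>M i\<in>?B. lborel))"
    by (intro nn_integral_cong nn_integral_lborel_translate) simp
  also have "\<dots> = (\<integral>\<^sup>+x. f x \<partial>lborel)"
    by (simp only: iterated[OF assms(4)])
  finally show ?thesis .
qed

text \<open>Induction over elementary linear maps. The induction predicate quantifies over all
  \<open>f\<close> because a composition applies the hypothesis for \<open>S\<close> to
  \<open>f\<close> and the one for \<open>T\<close> to \<open>f\<close> composed with
  \<open>S\<close>. Maps with an identically zero coordinate are excluded by the
  determinant.\<close>

lemma nn_integral_lborel_linear:
  fixes T :: "real^'n \<Rightarrow> real^'n" and f :: "real^'n \<Rightarrow> ennreal"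
  assumes "linear T" and "det (matrix T) \<noteq> 0" and "f \<in> borel_measurable borel"
  shows "(\<integral>\<^sup>+x. f x \<partial>lborel) = ennreal \<bar>det (matrix T)\<bar> * (\<integral>\<^sup>+x. f (T x) \<partial>lborel)"
proof -
  let ?P = "\<lambda>T :: real^'n \<Rightarrow> real^'n. det (matrix T) \<noteq> 0 \<longrightarrow>
    (\<forall>f :: real^'n \<Rightarrow> ennreal. f \<in> borel_measurable borel \<longrightarrow>
      (\<integral>\<^sup>+x. f x \<partial>lborel) = ennreal \<bar>det (matrix T)\<bar> * (\<integral>\<^sup>+x. f (T x) \<partial>lborel))"
  have inj: "inj (\<lambda>i::'n. axis i (1::real))"
    by (simp add: inj_def axis_eq_axis)
  have B: "(Basis :: (real^'n) set) = range (\<lambda>i. axis i 1)"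
    by (auto simp: Basis_vec_def)
  have "?P T"
  proof (rule induct_linear_elementary[OF \<open>linear T\<close>])
    fix S T :: "real^'n \<Rightarrow> real^'n"
    assume lin: "linear S" "linear T" and S: "?P S" and T: "?P T"
    have [measurable]: "S \<in> borel_measurable borel"
      using lin by (intro borel_measurable_continuous_onI linear_continuous_on)
        (simp add: linear_conv_bounded_linear)
    have d: "det (matrix (S \<circ> T)) = det (matrix S) * det (matrix T)"
      using lin by (simp add: matrix_compose det_mul)
    show "?P (S \<circ> T)"
    proof (intro impI allI)
      fix f :: "real^'n \<Rightarrow> ennreal"
      assume "det (matrix (S \<circ> T)) \<noteq> 0" and [measurable]: "f \<in> borel_measurable borel"
      then have "det (matrix S) \<noteq> 0" "det (matrix T) \<noteq> 0"
        by (auto simp: d)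
      have "(\<integral>\<^sup>+x. f x \<partial>lborel) = ennreal \<bar>det (matrix S)\<bar> * (\<integral>\<^sup>+x. f (S x) \<partial>lborel)"
        by (rule S[rule_format]) fact+
      also have "(\<integral>\<^sup>+x. f (S x) \<partial>lborel) = ennreal \<bar>det (matrix T)\<bar> * (\<integral>\<^sup>+x. f (S (T x)) \<partial>lborel)"
      proof (rule T[rule_format, of "\<lambda>x. f (S x)"])
        show "det (matrix T) \<noteq> 0"
          by fact
        show "(\<lambda>x. f (S x)) \<in> borel_measurable borel"
          by measurable
      qed
      finally show "(\<integral>\<^sup>+x. f x \<partial>lborel) =
          ennreal \<bar>det (matrix (S \<circ> T))\<bar> * (\<integral>\<^sup>+x. f ((S \<circ> T) x) \<partial>lborel)"
        by (simp add: d abs_mult ennreal_mult mult.assoc)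
    qed
  next
    fix T :: "real^'n \<Rightarrow> real^'n" and i
    assume "linear T" and 0: "\<And>x. T x $ i = 0"
    then have "\<not> inj T"
      by (metis linear_injective_imp_surjective one_neq_zero surjE vec_component)
    then show "?P T"
      using det_nz_iff_inj[OF \<open>linear T\<close>] by blast
  next
    fix c :: "'n \<Rightarrow> real"
    let ?T = "\<lambda>x :: real^'n. \<chi> i. c i * x $ i"
    have d: "det (matrix ?T) = (\<Prod>i\<in>UNIV. c i)"
      by (simp add: matrix_def axis_def det_diagonal)
    show "?P ?T"
    proof (intro impI allI)
      fix f :: "real^'n \<Rightarrow> ennreal"
      assume nz: "det (matrix ?T) \<noteq> 0" and [measurable]: "f \<in> borel_measurable borel"
      then have c: "c i \<noteq> 0" for i
        by (simp add: d)
      have [measurable]: "?T \<in> borel_measurable borel"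
        by (intro borel_measurable_continuous_onI continuous_intros)
      \<comment> \<open>The affine change of variables takes its coefficients indexed by basis
        vectors, so \<open>c\<close> is transported along the injective map from indices to
        \<open>axis i 1\<close>.\<close>
      define c' where "c' b = c (SOME i. b = axis i 1)" for b :: "real^'n"
      have ax: "c' (axis i 1) = c i" for i
        by (simp add: c'_def axis_eq_axis)
      have T: "?T x = 0 + (\<Sum>b\<in>Basis. (c' b * (x \<bullet> b)) *\<^sub>R b)" for x
      proof -
        have "(\<Sum>b\<in>Basis. (c' b * (x \<bullet> b)) *\<^sub>R b) = (\<Sum>i\<in>UNIV. (c i * x $ i) *\<^sub>R axis i 1)"
          unfolding B sum.reindex[OF inj] by (simp add: ax inner_axis)
        then show ?thesis
          by (simp add: vec_eq_iff axis_def if_distrib sum.delta cong: if_cong)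
      qed
      have "(lborel :: (real^'n) measure) =
          density (distr lborel borel (\<lambda>x. 0 + (\<Sum>b\<in>Basis. (c' b * (x \<bullet> b)) *\<^sub>R b))) (\<lambda>_. (\<Prod>b\<in>Basis. \<bar>c' b\<bar>))"
        by (rule lborel_affine_euclidean) (auto simp: B ax c)
      also have "(\<Prod>b\<in>(Basis :: (real^'n) set). \<bar>c' b\<bar>) = \<bar>det (matrix ?T)\<bar>"
        unfolding B prod.reindex[OF inj] d abs_prod by (simp add: ax)
      finally have "(\<integral>\<^sup>+x. f x \<partial>lborel) =
          (\<integral>\<^sup>+x. f x \<partial>density (distr lborel borel ?T) (\<lambda>_. ennreal \<bar>det (matrix ?T)\<bar>))"
        unfolding T[symmetric] by (rule arg_cong)
      then show "(\<integral>\<^sup>+x. f x \<partial>lborel) = ennreal \<bar>det (matrix ?T)\<bar> * (\<integral>\<^sup>+x. f (?T x) \<partial>lborel)"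
        by (simp add: nn_integral_density nn_integral_cmult nn_integral_distr)
    qed
  next
    fix m n :: 'n assume "m \<noteq> n"
    let ?t = "Transposition.transpose m n"
    let ?T = "\<lambda>x :: real^'n. \<chi> i. x $ ?t i"
    have [measurable]: "?T \<in> borel_measurable borel"
      by (intro borel_measurable_continuous_onI continuous_intros)
    have "matrix ?T = (\<chi> i. mat 1 $ ?t i)"
      by (simp add: matrix_def vec_eq_iff axis_def mat_def)
    then have d: "\<bar>det (matrix ?T)\<bar> = 1"
      by (simp add: det_permute_rows permutes_swap_id sign_swap_id abs_mult)
    \<comment> \<open>Lebesgue measure is determined by its values on boxes, and a coordinate swap
      sends a box to a box with the same side lengths in another order.\<close>
    have "lborel = distr lborel borel ?T"
    proof (rule lborel_eqI)
      fix l u :: "real^'n"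
      assume le: "\<And>b. b \<in> Basis \<Longrightarrow> l \<bullet> b \<le> u \<bullet> b"
      have le': "l $ i \<le> u $ i" for i
        using le[of "axis i 1"] by (simp add: inner_axis)
      have "?T -` box l u = box (?T l) (?T u)"
        by (auto simp: mem_box_cart) (metis transpose_involutory)+
      then have "emeasure (distr lborel borel ?T) (box l u) = emeasure lborel (box (?T l) (?T u))"
        by (simp add: emeasure_distr)
      also have "\<dots> = ennreal (\<Prod>b\<in>Basis. (?T u - ?T l) \<bullet> b)"
        using le' by (intro emeasure_lborel_box) (auto simp: Basis_vec_def inner_axis)
      also have "(\<Prod>b\<in>Basis. (?T u - ?T l) \<bullet> b) = (\<Prod>i\<in>UNIV. (u - l) $ ?t i)"
        unfolding B prod.reindex[OF inj] by (simp add: inner_axis)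
      also have "\<dots> = (\<Prod>i\<in>UNIV. (u - l) $ i)"
        using prod.permute[OF permutes_swap_id, of m UNIV n "\<lambda>i. (u - l) $ i"] by simp
      also have "\<dots> = (\<Prod>b\<in>Basis. (u - l) \<bullet> b)"
        unfolding B prod.reindex[OF inj] by (simp add: inner_axis)
      finally show "emeasure (distr lborel borel ?T) (box l u) = ennreal (\<Prod>b\<in>Basis. (u - l) \<bullet> b)" .
    qed simp
    note distr = this
    show "?P ?T"
    proof (intro impI allI)
      fix f :: "real^'n \<Rightarrow> ennreal"
      assume [measurable]: "f \<in> borel_measurable borel"
      have "(\<integral>\<^sup>+x. f x \<partial>lborel) = (\<integral>\<^sup>+x. f x \<partial>distr lborel borel ?T)"
        using distr by (rule arg_cong)
      then show "(\<integral>\<^sup>+x. f x \<partial>lborel) = ennreal \<bar>det (matrix ?T)\<bar> * (\<integral>\<^sup>+x. f (?T x) \<partial>lborel)"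
        unfolding d by (simp add: nn_integral_distr)
    qed
  next
    fix m n :: 'n assume mn: "m \<noteq> n"
    let ?T = "\<lambda>x :: real^'n. \<chi> i. if i = m then x $ m + x $ n else x $ i"
    \<comment> \<open>The matrix arises from the identity by adding row \<open>n\<close> to row
      \<open>m\<close>, so its determinant is 1; the map itself is a shear along two distinct basis
      vectors.\<close>
    have "matrix ?T = (\<chi> k. if k = m then row m (mat 1) + 1 *s row n (mat 1) else row k (mat 1))"
      by (auto simp: matrix_def vec_eq_iff axis_def mat_def row_def)
    then have d: "det (matrix ?T) = 1"
      using det_row_operation[OF mn, of "mat 1 :: real^'n^'n" 1] by simp
    have "?T x = x + (x \<bullet> axis n 1) *\<^sub>R axis m 1" for x
      by (simp add: inner_axis vec_eq_iff) (simp add: axis_def)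
    then show "?P ?T"
      unfolding d using mn by (simp add: nn_integral_lborel_shear axis_eq_axis)
  qed
  then show ?thesis
    using assms by blast
qed

section \<open>Null sets under translation and reflection\<close>

lemma AE_lborel_translate:
  fixes P :: "'a::euclidean_space \<Rightarrow> bool"
  assumes "AE x in lborel. P x"
  shows "AE x in lborel. P (x + z)"
proof -
  have "AE x in lborel. P (z + x)"
  proof (rule AE_distrD[where f = "(+) z" and M' = borel])
    show "AE x in distr lborel borel ((+) z). P x"
      unfolding lborel_distr_plus by (rule assms)
  qed simp
  then show ?thesis
    by (simp add: add.commute)
qed

lemma AE_lborel_uminus:
  fixes P :: "'a::euclidean_space \<Rightarrow> bool"
  assumes "AE x in lborel. P x"
  shows "AE x in lborel. P (- x)"
proof (rule AE_distrD[where f = uminus and M' = borel])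
  have "lborel = density (distr lborel borel (\<lambda>x. 0 + (-1) *\<^sub>R x :: 'a)) (\<lambda>_. \<bar>-1::real\<bar> ^ DIM('a))"
    by (rule lborel_affine) simp
  also have "\<dots> = distr lborel borel (uminus :: 'a \<Rightarrow> 'a)"
    by (simp add: density_1)
  finally show "AE x in distr lborel borel uminus. P x"
    using assms by metis
qed simp

subsection \<open>Slowly varying functions\<close>

text \<open>A tent of height 1 and radius \<open>L\<close> is Lipschitz with constant
  \<open>1 / L\<close>. A shift of length at most \<open>M\<close> thus changes its square norm by
  order \<open>M^2 L^(d-2)\<close>, negligible against the norm itself, of order \<open>L^d\<close>,
  once \<open>L\<close> is large.\<close>

lemma slowly_varying_bump:
  fixes M \<epsilon> :: real
  assumes "0 \<le> M" and "0 < \<epsilon>"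
  obtains \<phi> :: "'a::euclidean_space \<Rightarrow> real" and L :: real
  where "continuous_on UNIV \<phi>" and "\<And>x. 0 \<le> \<phi> x" and "\<And>x. L < norm x \<Longrightarrow> \<phi> x = 0" and "0 < L"
    and "0 < (\<integral>\<^sup>+x. ennreal ((\<phi> x)\<^sup>2) \<partial>lborel)" and "(\<integral>\<^sup>+x. ennreal ((\<phi> x)\<^sup>2) \<partial>lborel) < \<infinity>"
    and "\<And>v. norm v \<le> M \<Longrightarrow>
      (\<integral>\<^sup>+x. ennreal ((\<phi> x - \<phi> (x + v))\<^sup>2) \<partial>lborel) \<le> ennreal \<epsilon> * (\<integral>\<^sup>+x. ennreal ((\<phi> x)\<^sup>2) \<partial>lborel)"
proof -
  let ?d = "DIM('a)"
  \<comment> \<open>The summand 1 gives positivity, \<open>M\<close> keeps shifted supports inside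
    radius \<open>2 * L\<close>, and the last summand gives \<open>LM\<close>. There
    \<open>4 ^ d\<close> is the volume ratio of the balls of radii \<open>2 * L\<close> and
    \<open>L / 2\<close>, and one more 4 comes from the bound \<open>1 / 4\<close> for the squared
    tent on the smaller ball.\<close>
  define L where "L = 1 + M + M * 2 ^ (?d + 1) / sqrt \<epsilon>"
  have r: "0 \<le> M * 2 ^ (?d + 1) / sqrt \<epsilon>"
    using assms by simp
  have L: "0 < L" "M \<le> L"
    using assms r unfolding L_def by linarith+
  have "M * 2 ^ (?d + 1) / sqrt \<epsilon> \<le> L"
    using assms by (simp add: L_def)
  then have "(M * 2 ^ (?d + 1) / sqrt \<epsilon>)\<^sup>2 \<le> L\<^sup>2"
    using r by (intro power_mono) auto
  moreover have "(2 ^ (?d + 1) :: real)\<^sup>2 = 4 ^ (?d + 1)"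
    by (simp only: power2_eq_square flip: power_mult_distrib) simp
  ultimately have LM: "M\<^sup>2 * 4 ^ (?d + 1) \<le> \<epsilon> * L\<^sup>2"
    using assms by (simp add: power_mult_distrib power_divide field_simps)
  define \<phi> where "\<phi> x = max 0 (1 - norm x / L)" for x :: 'a
  have cont: "continuous_on UNIV \<phi>"
    using L unfolding \<phi>_def by (intro continuous_intros) auto
  have [measurable]: "\<phi> \<in> borel_measurable borel"
    using cont by (rule borel_measurable_continuous_onI)
  have nonneg: "0 \<le> \<phi> x" for x
    by (simp add: \<phi>_def)
  have supp: "\<phi> x = 0" if "L < norm x" for x
    using that L by (simp add: \<phi>_def)
  let ?P = "\<integral>\<^sup>+x. ennreal ((\<phi> x)\<^sup>2) \<partial>lborel"
  let ?v = "unit_ball_vol (real ?d)"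
  have v: "0 < ?v"
    by simp
  have lower: "ennreal (1 / 4 * (?v * (L / 2) ^ ?d)) \<le> ?P"
  proof -
    have "ennreal (1 / 4 * (?v * (L / 2) ^ ?d)) = ennreal (1 / 4) * emeasure lborel (cball (0::'a) (L / 2))"
      using L by (subst emeasure_cball) (auto simp flip: ennreal_mult)
    also have "\<dots> = (\<integral>\<^sup>+x. ennreal (1 / 4) * indicator (cball 0 (L / 2)) (x::'a) \<partial>lborel)"
      by (simp add: nn_integral_cmult_indicator)
    also have "\<dots> \<le> ?P"
    proof (rule nn_integral_mono)
      fix x :: 'a
      show "ennreal (1 / 4) * indicator (cball 0 (L / 2)) x \<le> ennreal ((\<phi> x)\<^sup>2)"
      proof (cases "norm x \<le> L / 2")
        case True
        then have "1 / 2 \<le> \<phi> x"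
          using L by (simp add: \<phi>_def field_simps)
        then have "(1 / 2)\<^sup>2 \<le> (\<phi> x)\<^sup>2"
          by (rule power_mono) simp
        then show ?thesis
          using True by (simp add: power2_eq_square)
      qed simp
    qed
    finally show ?thesis .
  qed
  have "0 < ennreal (1 / 4 * (?v * (L / 2) ^ ?d))"
    using L v by simp
  then have pos: "0 < ?P"
    using lower by (rule less_le_trans)
  have "?P \<le> (\<integral>\<^sup>+x. indicator (cball 0 L) (x::'a) \<partial>lborel)"
  proof (rule nn_integral_mono)
    fix x :: 'a
    have "(\<phi> x)\<^sup>2 \<le> 1" if "norm x \<le> L"
      using that L by (intro power_le_one) (auto simp: \<phi>_def)
    then show "ennreal ((\<phi> x)\<^sup>2) \<le> indicator (cball 0 L) x"
      using supp[of x] by (auto simp: indicator_def)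
  qed
  also have "\<dots> < \<infinity>"
    using L by (simp add: emeasure_cball)
  finally have fin: "?P < \<infinity>" .
  have "(\<integral>\<^sup>+x. ennreal ((\<phi> x - \<phi> (x + v))\<^sup>2) \<partial>lborel) \<le> ennreal \<epsilon> * ?P" if v: "norm v \<le> M" for v
  proof -
    have "(\<integral>\<^sup>+x. ennreal ((\<phi> x - \<phi> (x + v))\<^sup>2) \<partial>lborel)
        \<le> (\<integral>\<^sup>+x. ennreal ((M / L)\<^sup>2) * indicator (cball 0 (2 * L)) (x::'a) \<partial>lborel)"
    proof (rule nn_integral_mono)
      fix x :: 'a
      show "ennreal ((\<phi> x - \<phi> (x + v))\<^sup>2) \<le> ennreal ((M / L)\<^sup>2) * indicator (cball 0 (2 * L)) x"
      proof (cases "norm x \<le> 2 * L")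
        case True
        have "\<bar>norm (x + v) - norm x\<bar> \<le> M"
          using v norm_triangle_ineq3[of "x + v" x] by simp
        then have "\<bar>norm (x + v) / L - norm x / L\<bar> \<le> M / L"
          using L by (simp add: abs_divide divide_right_mono flip: diff_divide_distrib)
        then have "\<bar>\<phi> x - \<phi> (x + v)\<bar> \<le> M / L"
          unfolding \<phi>_def by linarith
        then have "(\<phi> x - \<phi> (x + v))\<^sup>2 \<le> (M / L)\<^sup>2"
          by (metis abs_ge_zero power2_abs power_mono)
        then show ?thesis
          using True by simp
      next
        case False
        \<comment> \<open>Since \<open>norm v \<le> M\<close> and \<open>M \<le> L\<close>, both
          \<open>x\<close> and \<open>x + v\<close> lie outside the support.\<close>
        then have "L < norm (x + v)"
          using v L norm_diff_ineq[of x v] by linarith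
        then show ?thesis
          using False L by (simp add: supp)
      qed
    qed
    also have "\<dots> = ennreal ((M / L)\<^sup>2 * (?v * (2 * L) ^ ?d))"
      using L by (simp add: nn_integral_cmult_indicator emeasure_cball ennreal_mult)
    also have "\<dots> \<le> ennreal (\<epsilon> * (1 / 4 * (?v * (L / 2) ^ ?d)))"
    proof (rule ennreal_leI)
      have "(M / L)\<^sup>2 * 4 ^ (?d + 1) \<le> \<epsilon>"
        using LM L by (simp add: power_divide field_simps)
      then have "(M / L)\<^sup>2 * 4 ^ (?d + 1) * (1 / 4 * (?v * (L / 2) ^ ?d)) \<le> \<epsilon> * (1 / 4 * (?v * (L / 2) ^ ?d))"
        using L by (intro mult_right_mono) auto
      moreover have "(2 * L) ^ ?d = 4 ^ ?d * (L / 2) ^ ?d"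
        using power_mult_distrib[of 4 "L / 2" ?d] by simp
      then have "(M / L)\<^sup>2 * (?v * (2 * L) ^ ?d) = (M / L)\<^sup>2 * 4 ^ (?d + 1) * (1 / 4 * (?v * (L / 2) ^ ?d))"
        by (simp only: power_add power_one_right) simp
      ultimately show "(M / L)\<^sup>2 * (?v * (2 * L) ^ ?d) \<le> \<epsilon> * (1 / 4 * (?v * (L / 2) ^ ?d))"
        by (simp only:)
    qed
    also have "\<dots> \<le> ennreal \<epsilon> * ?P"
    proof -
      have "ennreal (\<epsilon> * (1 / 4 * (?v * (L / 2) ^ ?d))) = ennreal \<epsilon> * ennreal (1 / 4 * (?v * (L / 2) ^ ?d))"
        using assms L by (intro ennreal_mult) auto
      also have "\<dots> \<le> ennreal \<epsilon> * ?P"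
        using lower by (rule mult_left_mono) simp
      finally show ?thesis .
    qed
    finally show ?thesis .
  qed
  with cont nonneg supp L(1) pos fin show ?thesis
    by (rule that)
qed

text \<open>For nonnegative terms the cross products only help. This is where positivity of the bump
  forces the square norm of the sum to grow at least linearly in the number of terms.\<close>

lemma sum_power2_le_power2_sum:
  fixes a :: "'i \<Rightarrow> real"
  assumes "finite I" and "\<And>i. i \<in> I \<Longrightarrow> 0 \<le> a i"
  shows "(\<Sum>i\<in>I. (a i)\<^sup>2) \<le> (\<Sum>i\<in>I. a i)\<^sup>2"
proof -
  have "(\<Sum>i\<in>I. a i * a i) \<le> (\<Sum>i\<in>I. a i * sum a I)"
    using assms by (intro sum_mono mult_left_mono member_le_sum) auto
  then show ?thesis
    by (simp add: power2_eq_square sum_distrib_right)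
qed

subsection \<open>The energy of a linear map\<close>

text \<open>For \<open>T = (*v) A\<close> the factor \<open>s\<close> is \<open>\<bar>det A\<bar> powr (- 1 / 2)\<close>.\<close>
locale scaling_map =
  fixes T :: "'a::euclidean_space \<Rightarrow> 'a" and s :: real
  assumes linear_T: "linear T"
    and inj_T: "inj T"
    and s_pos: "0 < s"
    and nn_integral_T: "\<And>f :: 'a \<Rightarrow> ennreal. f \<in> borel_measurable borel \<Longrightarrow>
      (\<integral>\<^sup>+x. f (T x) \<partial>lborel) = ennreal (s\<^sup>2) * (\<integral>\<^sup>+x. f x \<partial>lborel)"
begin

lemma continuous_T: "continuous_on S T"
  using linear_T by (rule linear_continuous_on[OF linear_conv_bounded_linear[THEN iffD1]])

lemma measurable_T [measurable]: "T \<in> borel_measurable borel"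
  by (rule borel_measurable_continuous_onI[OF continuous_T])

text \<open>Enlarge the exceptional set to a Borel null set; by \<open>nn_integral_T\<close> its
  preimage has measure \<open>s^2\<close> times zero.\<close>

lemma AE_T:
  assumes "AE x in lborel. P x"
  shows "AE x in lborel. P (T x)"
proof -
  obtain N where N: "{x. \<not> P x} \<subseteq> N" "N \<in> null_sets lborel"
    using assms by (auto simp: eventually_ae_filter)
  then have [measurable]: "N \<in> sets borel"
    by auto
  have "(\<integral>\<^sup>+x. indicator N (T x) \<partial>lborel) = 0"
    using N by (subst nn_integral_T) auto
  then have "AE x in lborel. indicator N (T x) = (0::ennreal)"
    by (subst (asm) nn_integral_0_iff_AE) auto
  then show ?thesis
    using N(1) by (auto simp: indicator_def)
qed

text \<open>The energy of \<open>w\<close> along the graph of \<open>x \<mapsto> T x + z\<close>: pointwise,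
  \<open>(u - v)\<^sup>2 = (1 - s) u\<^sup>2 + (1 - 1/s) v\<^sup>2 + s (u - v/s)\<^sup>2\<close>, and the square norm of \<open>v = w \<circ> (T + z)\<close>
  is \<open>s\<^sup>2\<close> times that of \<open>u = w\<close>.\<close>
lemma shift_energy:
  fixes w :: "'a \<Rightarrow> real"
  assumes [measurable]: "w \<in> borel_measurable borel"
    and fin: "(\<integral>\<^sup>+x. ennreal ((w x)\<^sup>2) \<partial>lborel) < \<infinity>"
  shows "(\<integral>\<^sup>+x. ennreal ((w x - w (T x + z))\<^sup>2) \<partial>lborel) =
    ennreal ((1 - s)\<^sup>2) * (\<integral>\<^sup>+x. ennreal ((w x)\<^sup>2) \<partial>lborel)
    + ennreal s * (\<integral>\<^sup>+x. ennreal ((w x - w (T x + z) / s)\<^sup>2) \<partial>lborel)"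
    (is "?J = ennreal ((1 - s)\<^sup>2) * ?D + ennreal s * ?F")
proof -
  let ?V = "\<integral>\<^sup>+x. ennreal ((w (T x + z))\<^sup>2) \<partial>lborel"
  obtain D where D: "?D = ennreal D" "0 \<le> D"
    using fin by (metis ennreal_cases infinity_ennreal_def less_irrefl)
  have V: "?V = ennreal (s\<^sup>2 * D)"
    using nn_integral_T[of "\<lambda>x. ennreal ((w (x + z))\<^sup>2)"]
      nn_integral_lborel_translate[of "\<lambda>x. ennreal ((w x)\<^sup>2)" z] D
    by (simp add: ennreal_mult)
  \<comment> \<open>The coefficients \<open>1 - s\<close> and \<open>1 - 1/s\<close> of the
    pointwise identity may be negative, so their negative parts are moved to the left to keep every
    integrand nonnegative.\<close>
  have "?J + ennreal s * ?D + ennreal (1 / s) * ?V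
      = (\<integral>\<^sup>+x. ennreal ((w x - w (T x + z))\<^sup>2) + ennreal s * ennreal ((w x)\<^sup>2)
          + ennreal (1 / s) * ennreal ((w (T x + z))\<^sup>2) \<partial>lborel)"
    by (simp add: nn_integral_add nn_integral_cmult)
  also have "\<dots> = (\<integral>\<^sup>+x. ennreal ((w x)\<^sup>2) + ennreal ((w (T x + z))\<^sup>2)
          + ennreal s * ennreal ((w x - w (T x + z) / s)\<^sup>2) \<partial>lborel)"
  proof (rule nn_integral_cong)
    fix x
    have "(w x - w (T x + z))\<^sup>2 + s * (w x)\<^sup>2 + (1 / s) * (w (T x + z))\<^sup>2
        = (w x)\<^sup>2 + (w (T x + z))\<^sup>2 + s * (w x - w (T x + z) / s)\<^sup>2"
      using s_pos by (simp add: power2_eq_square field_simps)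
    then show "ennreal ((w x - w (T x + z))\<^sup>2) + ennreal s * ennreal ((w x)\<^sup>2)
          + ennreal (1 / s) * ennreal ((w (T x + z))\<^sup>2)
        = ennreal ((w x)\<^sup>2) + ennreal ((w (T x + z))\<^sup>2)
          + ennreal s * ennreal ((w x - w (T x + z) / s)\<^sup>2)"
      using s_pos by (simp flip: ennreal_mult ennreal_plus)
  qed
  also have "\<dots> = ?D + ?V + ennreal s * ?F"
    by (simp add: nn_integral_add nn_integral_cmult)
  finally have "?J + ennreal s * ?D + ennreal (1 / s) * ?V = ?D + ?V + ennreal s * ?F" .
  \<comment> \<open>The two added terms contribute \<open>s * D\<close> each. Their sum is finite,
    which permits cancelling it at the end.\<close>
  moreover have "ennreal s * ?D + ennreal (1 / s) * ?V = ennreal (2 * s * D)"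
  proof -
    have "s * D + 1 / s * (s\<^sup>2 * D) = 2 * s * D"
      using s_pos by (simp add: power2_eq_square)
    then show ?thesis
      using s_pos D unfolding V by (simp flip: ennreal_mult ennreal_plus)
  qed
  moreover have "?D + ?V = ennreal (D + s\<^sup>2 * D)"
    using D by (simp add: V)
  ultimately have "?J + ennreal (2 * s * D) = ennreal (D + s\<^sup>2 * D) + ennreal s * ?F"
    by (simp only: add.assoc)
  also have "D + s\<^sup>2 * D = (1 - s)\<^sup>2 * D + 2 * s * D"
    by (simp add: power2_eq_square algebra_simps)
  also have "ennreal \<dots> = ennreal ((1 - s)\<^sup>2) * ?D + ennreal (2 * s * D)"
    using s_pos D by (simp add: ennreal_mult)
  finally have "?J + ennreal (2 * s * D) =
      (ennreal ((1 - s)\<^sup>2) * ?D + ennreal s * ?F) + ennreal (2 * s * D)"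
    by (simp add: ac_simps)
  then show ?thesis
    by simp
qed

text \<open>The numerator of the quotient in \<open>lambda1\<close>, with \<open>w\<close> already
  extended to the whole space. Variables and order of integration are those of
  \<open>lambda1\<close>, so that unfolding makes the two coincide.\<close>

definition energy :: "('a \<Rightarrow> real) \<Rightarrow> ('a \<Rightarrow> real) \<Rightarrow> ennreal" where
  "energy \<psi> w = (\<integral>\<^sup>+y. (\<integral>\<^sup>+x. ennreal ((\<psi> (y - T x) + \<psi> (x - T y)) * (w x - w y)\<^sup>2) \<partial>lebesgue) \<partial>lebesgue)"

text \<open>This allows Lebesgue measurable data to be replaced by Borel versions, for which
  composition with \<open>T\<close> and Fubini are available. For fixed \<open>y\<close>, null sets
  pull back to null sets under both arguments of the kernel.\<close>

lemma energy_cong_AE: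
  assumes \<psi>: "AE z in lborel. \<psi> z = \<psi>' z" and w: "AE x in lborel. w x = w' x"
  shows "energy \<psi> w = energy \<psi>' w'"
proof -
  have "(\<integral>\<^sup>+x. ennreal ((\<psi> (y - T x) + \<psi> (x - T y)) * (w x - w y)\<^sup>2) \<partial>lborel)
      = (\<integral>\<^sup>+x. ennreal ((\<psi>' (y - T x) + \<psi>' (x - T y)) * (w' x - w' y)\<^sup>2) \<partial>lborel)"
    if "w y = w' y" for y
  proof (rule nn_integral_cong_AE)
    \<comment> \<open>The map from \<open>x\<close> to \<open>y - T x\<close> is handled in three
      stages: translation by \<open>y\<close>, reflection, then \<open>T\<close>.\<close>
    have "AE x in lborel. \<psi> (x + y) = \<psi>' (x + y)"
      using \<psi> by (rule AE_lborel_translate)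
    then have "AE x in lborel. \<psi> (- x + y) = \<psi>' (- x + y)"
      by (rule AE_lborel_uminus)
    then have 1: "AE x in lborel. \<psi> (- T x + y) = \<psi>' (- T x + y)"
      by (rule AE_T)
    have 2: "AE x in lborel. \<psi> (x + - T y) = \<psi>' (x + - T y)"
      using \<psi> by (rule AE_lborel_translate)
    show "AE x in lborel. ennreal ((\<psi> (y - T x) + \<psi> (x - T y)) * (w x - w y)\<^sup>2)
        = ennreal ((\<psi>' (y - T x) + \<psi>' (x - T y)) * (w' x - w' y)\<^sup>2)"
      using 1 2 w by eventually_elim (simp add: that)
  qed
  then show ?thesis
    unfolding energy_def nn_integral_completion using w by (intro nn_integral_cong_AE) auto
qed

text \<open>The two kernel terms are exchanged by swapping \<open>x\<close> and \<open>y\<close>,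
  while the squared difference is symmetric; hence the factor 2. In one of them,
  \<open>y = T x + z\<close> is substituted for fixed \<open>x\<close>, and then the integrals over
  \<open>x\<close> and \<open>z\<close> are interchanged.\<close>

lemma energy_borel:
  assumes nonneg: "\<And>z. 0 \<le> \<psi> z"
    and [measurable]: "\<psi> \<in> borel_measurable borel" "w \<in> borel_measurable borel"
  shows "energy \<psi> w = 2 * (\<integral>\<^sup>+z. ennreal (\<psi> z) * (\<integral>\<^sup>+x. ennreal ((w x - w (T x + z))\<^sup>2) \<partial>lborel) \<partial>lborel)"
    (is "_ = 2 * ?I")
proof -
  let ?f = "\<lambda>x y. ennreal (\<psi> (y - T x)) * ennreal ((w x - w y)\<^sup>2)"
  have "energy \<psi> w = (\<integral>\<^sup>+y. (\<integral>\<^sup>+x. ?f x y + ?f y x \<partial>lborel) \<partial>lborel)"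
    unfolding energy_def nn_integral_completion
    by (simp add: nonneg ennreal_mult distrib_right power2_commute)
  also have "\<dots> = (\<integral>\<^sup>+y. (\<integral>\<^sup>+x. ?f x y \<partial>lborel) \<partial>lborel) + (\<integral>\<^sup>+y. (\<integral>\<^sup>+x. ?f y x \<partial>lborel) \<partial>lborel)"
    by (simp add: nn_integral_add)
  also have "(\<integral>\<^sup>+y. (\<integral>\<^sup>+x. ?f x y \<partial>lborel) \<partial>lborel) = (\<integral>\<^sup>+x. (\<integral>\<^sup>+y. ?f x y \<partial>lborel) \<partial>lborel)"
    by (rule lborel_pair.Fubini') measurable
  also have "(\<integral>\<^sup>+x. (\<integral>\<^sup>+y. ?f x y \<partial>lborel) \<partial>lborel) = ?I"
  proof -
    have "(\<integral>\<^sup>+y. ?f x y \<partial>lborel) = (\<integral>\<^sup>+z. ennreal (\<psi> z) * ennreal ((w x - w (T x + z))\<^sup>2) \<partial>lborel)" for x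
      using nn_integral_lborel_translate[of "?f x" "T x"] by (simp add: add.commute)
    then have "(\<integral>\<^sup>+x. (\<integral>\<^sup>+y. ?f x y \<partial>lborel) \<partial>lborel)
        = (\<integral>\<^sup>+x. (\<integral>\<^sup>+z. ennreal (\<psi> z) * ennreal ((w x - w (T x + z))\<^sup>2) \<partial>lborel) \<partial>lborel)"
      by (simp only:)
    also have "\<dots> = (\<integral>\<^sup>+z. (\<integral>\<^sup>+x. ennreal (\<psi> z) * ennreal ((w x - w (T x + z))\<^sup>2) \<partial>lborel) \<partial>lborel)"
      by (rule lborel_pair.Fubini'[symmetric]) measurable
    finally show ?thesis
      by (simp add: nn_integral_cmult)
  qed
  finally show ?thesis
    by (simp add: mult_2)
qed

lemma energy_eq:
  assumes nonneg: "\<And>z. 0 \<le> \<psi> z" and \<psi>: "\<psi> \<in> borel_measurable lebesgue"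
    and [measurable]: "w \<in> borel_measurable borel"
    and fin: "(\<integral>\<^sup>+x. ennreal ((w x)\<^sup>2) \<partial>lborel) < \<infinity>"
  shows "energy \<psi> w = 2 * (ennreal ((1 - s)\<^sup>2) * (\<integral>\<^sup>+x. ennreal ((w x)\<^sup>2) \<partial>lborel) * (\<integral>\<^sup>+z. ennreal (\<psi> z) \<partial>lborel)
    + ennreal s * (\<integral>\<^sup>+z. ennreal (\<psi> z) * (\<integral>\<^sup>+x. ennreal ((w x - w (T x + z) / s)\<^sup>2) \<partial>lborel) \<partial>lborel))"
proof -
  obtain \<psi>0 where \<psi>0: "\<psi>0 \<in> borel_measurable lborel" "AE z in lborel. \<psi> z = \<psi>0 z"
    using completion_ex_borel_measurable_real[OF \<psi>] by blast
  \<comment> \<open>The Borel version \<open>\<psi>0\<close> is nonnegative only almost everywhere;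
    truncation makes it nonnegative everywhere, as \<open>energy_borel\<close> demands.\<close>
  define \<psi>' where "\<psi>' z = max 0 (\<psi>0 z)" for z
  have [measurable]: "\<psi>' \<in> borel_measurable borel"
    using \<psi>0(1) unfolding \<psi>'_def by simp
  have eq: "AE z in lborel. \<psi> z = \<psi>' z"
    using \<psi>0(2) by eventually_elim (metis \<psi>'_def max.absorb2 nonneg)
  have nonneg': "0 \<le> \<psi>' z" for z
    by (simp add: \<psi>'_def)
  let ?D = "\<integral>\<^sup>+x. ennreal ((w x)\<^sup>2) \<partial>lborel"
  let ?F = "\<lambda>z. \<integral>\<^sup>+x. ennreal ((w x - w (T x + z) / s)\<^sup>2) \<partial>lborel"
  have "energy \<psi> w = energy \<psi>' w"
    using eq by (intro energy_cong_AE) auto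
  also have "\<dots> = 2 * (\<integral>\<^sup>+z. ennreal (\<psi>' z) * (ennreal ((1 - s)\<^sup>2) * ?D + ennreal s * ?F z) \<partial>lborel)"
    by (simp add: energy_borel nonneg' shift_energy[OF assms(3) fin])
  also have "\<dots> = 2 * (\<integral>\<^sup>+z. ennreal ((1 - s)\<^sup>2) * ?D * ennreal (\<psi>' z) + ennreal s * (ennreal (\<psi>' z) * ?F z) \<partial>lborel)"
    by (simp add: algebra_simps)
  also have "\<dots> = 2 * (ennreal ((1 - s)\<^sup>2) * ?D * (\<integral>\<^sup>+z. ennreal (\<psi>' z) \<partial>lborel)
      + ennreal s * (\<integral>\<^sup>+z. ennreal (\<psi>' z) * ?F z \<partial>lborel))"
    by (simp add: nn_integral_add nn_integral_cmult)
  also have "(\<integral>\<^sup>+z. ennreal (\<psi>' z) \<partial>lborel) = (\<integral>\<^sup>+z. ennreal (\<psi> z) \<partial>lborel)"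
    using eq by (intro nn_integral_cong_AE) auto
  also have "(\<integral>\<^sup>+z. ennreal (\<psi>' z) * ?F z \<partial>lborel) = (\<integral>\<^sup>+z. ennreal (\<psi> z) * ?F z \<partial>lborel)"
    using eq by (intro nn_integral_cong_AE) auto
  finally show ?thesis .
qed

text \<open>After passing to a Borel version of \<open>w\<close>, drop the nonnegative remainder in
  \<open>energy_eq\<close>.\<close>

lemma energy_ge:
  assumes nonneg: "\<And>z. 0 \<le> \<psi> z" and \<psi>: "\<psi> \<in> borel_measurable lebesgue"
    and w: "w \<in> borel_measurable lebesgue"
    and fin: "(\<integral>\<^sup>+x. ennreal ((w x)\<^sup>2) \<partial>lborel) < \<infinity>"
  shows "2 * (ennreal ((1 - s)\<^sup>2) * (\<integral>\<^sup>+x. ennreal ((w x)\<^sup>2) \<partial>lborel) * (\<integral>\<^sup>+z. ennreal (\<psi> z) \<partial>lborel))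
    \<le> energy \<psi> w"
proof -
  obtain w' where w': "w' \<in> borel_measurable lborel" "AE x in lborel. w x = w' x"
    using completion_ex_borel_measurable_real[OF w] by blast
  have D: "(\<integral>\<^sup>+x. ennreal ((w x)\<^sup>2) \<partial>lborel) = (\<integral>\<^sup>+x. ennreal ((w' x)\<^sup>2) \<partial>lborel)"
    using w'(2) by (intro nn_integral_cong_AE) auto
  have "energy \<psi> w = energy \<psi> w'"
    using w'(2) by (intro energy_cong_AE) auto
  then show ?thesis
    using energy_eq[OF nonneg \<psi>, of w'] w'(1) fin unfolding D
    by (simp add: distrib_left)
qed

lemma energy_le:
  assumes nonneg: "\<And>z. 0 \<le> \<psi> z" and \<psi>: "\<psi> \<in> borel_measurable lebesgue"
    and supp: "{z. \<psi> z \<noteq> 0} \<subseteq> cball 0 1"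
    and w: "w \<in> borel_measurable borel"
    and fin: "(\<integral>\<^sup>+x. ennreal ((w x)\<^sup>2) \<partial>lborel) < \<infinity>"
    and C: "\<And>z. norm z \<le> 1 \<Longrightarrow> (\<integral>\<^sup>+x. ennreal ((w x - w (T x + z) / s)\<^sup>2) \<partial>lborel) \<le> C"
  shows "energy \<psi> w \<le> 2 * (ennreal ((1 - s)\<^sup>2) * (\<integral>\<^sup>+x. ennreal ((w x)\<^sup>2) \<partial>lborel) + ennreal s * C) *
    (\<integral>\<^sup>+z. ennreal (\<psi> z) \<partial>lborel)"
proof -
  \<comment> \<open>The right-hand integral is taken over \<open>lebesgue\<close> because
    \<open>\<psi>\<close> is only Lebesgue measurable, and \<open>C\<close> is to be pulled out of
    it.\<close>
  have "(\<integral>\<^sup>+z. ennreal (\<psi> z) * (\<integral>\<^sup>+x. ennreal ((w x - w (T x + z) / s)\<^sup>2) \<partial>lborel) \<partial>lborel)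
      \<le> (\<integral>\<^sup>+z. C * ennreal (\<psi> z) \<partial>lebesgue)"
    unfolding nn_integral_completion
  proof (rule nn_integral_mono)
    fix z
    show "ennreal (\<psi> z) * (\<integral>\<^sup>+x. ennreal ((w x - w (T x + z) / s)\<^sup>2) \<partial>lborel) \<le> C * ennreal (\<psi> z)"
    proof (cases "\<psi> z = 0")
      case False
      then have "norm z \<le> 1"
        using supp by auto
      then show ?thesis
        using C by (subst mult.commute) (intro mult_right_mono, auto)
    qed simp
  qed
  also have "\<dots> = C * (\<integral>\<^sup>+z. ennreal (\<psi> z) \<partial>lborel)"
    using \<psi> by (subst nn_integral_cmult) (auto simp: nn_integral_completion)
  finally have "ennreal s * (\<integral>\<^sup>+z. ennreal (\<psi> z) * (\<integral>\<^sup>+x. ennreal ((w x - w (T x + z) / s)\<^sup>2) \<partial>lborel) \<partial>lborel)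
      \<le> ennreal s * C * (\<integral>\<^sup>+z. ennreal (\<psi> z) \<partial>lborel)"
    unfolding mult.assoc by (rule mult_left_mono) simp
  then have "2 * (ennreal ((1 - s)\<^sup>2) * (\<integral>\<^sup>+x. ennreal ((w x)\<^sup>2) \<partial>lborel) * (\<integral>\<^sup>+z. ennreal (\<psi> z) \<partial>lborel)
      + ennreal s * (\<integral>\<^sup>+z. ennreal (\<psi> z) * (\<integral>\<^sup>+x. ennreal ((w x - w (T x + z) / s)\<^sup>2) \<partial>lborel) \<partial>lborel))
    \<le> 2 * (ennreal ((1 - s)\<^sup>2) * (\<integral>\<^sup>+x. ennreal ((w x)\<^sup>2) \<partial>lborel) * (\<integral>\<^sup>+z. ennreal (\<psi> z) \<partial>lborel)
      + ennreal s * C * (\<integral>\<^sup>+z. ennreal (\<psi> z) \<partial>lborel))"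
    by (intro mult_left_mono add_mono order_refl) simp_all
  then show ?thesis
    unfolding energy_eq[OF nonneg \<psi> w fin] by (simp only: distrib_right mult.assoc)
qed

subsection \<open>Almost invariant functions\<close>

lemma linear_T_pow: "linear (T ^^ k)"
proof (induction k)
  case (Suc k)
  then show ?case
    using linear_compose[OF Suc linear_T] by (simp add: comp_def)
qed (simp add: linear_iff)

lemma measurable_T_pow [measurable]: "T ^^ k \<in> borel_measurable borel"
  using linear_T_pow
  by (intro borel_measurable_continuous_onI linear_continuous_on) (simp add: linear_conv_bounded_linear)

lemma nn_integral_T_pow:
  fixes f :: "'a \<Rightarrow> ennreal"
  assumes [measurable]: "f \<in> borel_measurable borel"
  shows "(\<integral>\<^sup>+x. f ((T ^^ k) x) \<partial>lborel) = ennreal ((s\<^sup>2) ^ k) * (\<integral>\<^sup>+x. f x \<partial>lborel)"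
proof (induction k)
  case (Suc k)
  have "(\<integral>\<^sup>+x. f ((T ^^ Suc k) x) \<partial>lborel) = (\<integral>\<^sup>+x. f ((T ^^ k) (T x)) \<partial>lborel)"
    by (simp only: funpow_Suc_right comp_apply)
  also have "\<dots> = ennreal (s\<^sup>2) * (\<integral>\<^sup>+x. f ((T ^^ k) x) \<partial>lborel)"
    by (rule nn_integral_T) simp
  finally show ?case
    by (simp add: Suc ennreal_mult mult.assoc)
qed simp

text \<open>Dividing by \<open>s ^ k\<close> offsets the Jacobian factor \<open>s ^ (2 k)\<close>
  after squaring, so composition with \<open>T ^^ k\<close> becomes an isometry of L^2.\<close>

lemma nn_integral_T_pow_square:
  fixes f :: "'a \<Rightarrow> real"
  assumes [measurable]: "f \<in> borel_measurable borel"
  shows "(\<integral>\<^sup>+x. ennreal ((f ((T ^^ k) x) / s ^ k)\<^sup>2) \<partial>lborel) = (\<integral>\<^sup>+x. ennreal ((f x)\<^sup>2) \<partial>lborel)"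
proof -
  have "(f ((T ^^ k) x) / s ^ k)\<^sup>2 = (1 / (s\<^sup>2) ^ k) * (f ((T ^^ k) x))\<^sup>2" for x
    by (simp add: power_divide mult.commute flip: power_mult)
  then have "(\<integral>\<^sup>+x. ennreal ((f ((T ^^ k) x) / s ^ k)\<^sup>2) \<partial>lborel)
      = (\<integral>\<^sup>+x. ennreal (1 / (s\<^sup>2) ^ k) * ennreal ((f ((T ^^ k) x))\<^sup>2) \<partial>lborel)"
    by (subst ennreal_mult[symmetric]) simp_all
  also have "\<dots> = ennreal (1 / (s\<^sup>2) ^ k) * (ennreal ((s\<^sup>2) ^ k) * (\<integral>\<^sup>+x. ennreal ((f x)\<^sup>2) \<partial>lborel))"
    using nn_integral_T_pow[of "\<lambda>x. ennreal ((f x)\<^sup>2)" k] by (simp add: nn_integral_cmult)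
  also have "\<dots> = (\<integral>\<^sup>+x. ennreal ((f x)\<^sup>2) \<partial>lborel)"
    using s_pos by (simp flip: mult.assoc ennreal_mult)
  finally show ?thesis .
qed

text \<open>An injective linear map is bounded below. A single constant for all \<open>k < N\<close>
  ensures that the sum of the \<open>N\<close> rescaled bumps has bounded support.\<close>

lemma T_pow_expand_bound:
  obtains B where "0 < B" and "\<And>k x. k < N \<Longrightarrow> norm x \<le> B * norm ((T ^^ k) x)"
proof -
  obtain b where b: "0 < b" "\<And>x. b * norm x \<le> norm (T x)"
    using linear_inj_bounded_below_pos[OF linear_T inj_T] by (metis mult.commute)
  \<comment> \<open>Taking \<open>c\<close> at least 1 makes its powers increasing, so
    \<open>c ^ N\<close> dominates every \<open>c ^ k\<close> with \<open>k < N\<close>.\<close>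
  define c where "c = max 1 (1 / b)"
  have c: "1 \<le> c" "norm x \<le> c * norm (T x)" for x
  proof -
    have "norm x \<le> 1 / b * norm (T x)"
      using b by (simp add: field_simps)
    also have "\<dots> \<le> c * norm (T x)"
      by (intro mult_right_mono) (auto simp: c_def)
    finally show "norm x \<le> c * norm (T x)" .
  qed (simp add: c_def)
  have pow: "norm x \<le> c ^ k * norm ((T ^^ k) x)" for k x
  proof (induction k)
    case (Suc k)
    also have "c ^ k * norm ((T ^^ k) x) \<le> c ^ k * (c * norm (T ((T ^^ k) x)))"
      using c by (intro mult_left_mono) auto
    finally show ?case
      by (simp add: mult_ac)
  qed simp
  show ?thesis
  proof (rule that[of "c ^ N"])
    show "norm x \<le> c ^ N * norm ((T ^^ k) x)" if "k < N" for k x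
    proof -
      have "c ^ k * norm ((T ^^ k) x) \<le> c ^ N * norm ((T ^^ k) x)"
        using c that by (intro mult_right_mono power_increasing) auto
      with pow show ?thesis
        by (rule order_trans)
    qed
  qed (use c in auto)
qed

text \<open>Applying the shifted isometry moves each summand \<open>g k\<close> to
  \<open>g (Suc k)\<close> up to an error \<open>e k\<close>. Telescoping leaves the two end terms
  and the sum of the errors, each of these three of square norm at most \<open>?P\<close>, while
  \<open>u\<close> has square norm at least \<open>N\<close> times \<open>?P\<close>.\<close>

lemma almost_invariant_function:
  assumes N: "0 < N"
  obtains u :: "'a \<Rightarrow> real" and R :: real
  where "u \<in> borel_measurable borel" and "\<And>x. R \<le> norm x \<Longrightarrow> u x = 0"
    and "0 < (\<integral>\<^sup>+x. ennreal ((u x)\<^sup>2) \<partial>lborel)" and "(\<integral>\<^sup>+x. ennreal ((u x)\<^sup>2) \<partial>lborel) < \<infinity>"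
    and "\<And>z. norm z \<le> 1 \<Longrightarrow>
      (\<integral>\<^sup>+x. ennreal ((u x - u (T x + z) / s)\<^sup>2) \<partial>lborel) \<le> ennreal (9 / real N) * (\<integral>\<^sup>+x. ennreal ((u x)\<^sup>2) \<partial>lborel)"
proof -
  define M where "M = (\<Sum>k<N. onorm (T ^^ k))"
  have bl: "bounded_linear (T ^^ k)" for k
    using linear_T_pow by (simp add: linear_conv_bounded_linear)
  have M: "norm ((T ^^ k) z) \<le> M" if "k < N" "norm z \<le> 1" for k z
  proof -
    have "norm ((T ^^ k) z) \<le> onorm (T ^^ k) * norm z"
      by (rule onorm[OF bl])
    also have "\<dots> \<le> onorm (T ^^ k)"
      using that onorm_pos_le[OF bl[of k]] by (simp add: mult_left_le)
    also have "\<dots> \<le> M"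
      unfolding M_def using that onorm_pos_le[OF bl] by (intro member_le_sum) auto
    finally show ?thesis .
  qed
  have "0 \<le> M"
    unfolding M_def by (intro sum_nonneg onorm_pos_le bl)
  \<comment> \<open>With tolerance \<open>1 / N^2\<close> per error, Cauchy-Schwarz bounds the
    square norm of the sum of \<open>N\<close> errors by \<open>N * N / N^2 = 1\<close> times
    \<open>?P\<close>.\<close>
  moreover have "0 < 1 / (real N)\<^sup>2"
    using N by simp
  ultimately obtain \<phi> :: "'a \<Rightarrow> real" and L where
    cont: "continuous_on UNIV \<phi>" and nonneg: "\<And>x. 0 \<le> \<phi> x"
    and supp: "\<And>x. L < norm x \<Longrightarrow> \<phi> x = 0" and L: "0 < L"
    and pos: "0 < (\<integral>\<^sup>+x. ennreal ((\<phi> x)\<^sup>2) \<partial>lborel)" and fin: "(\<integral>\<^sup>+x. ennreal ((\<phi> x)\<^sup>2) \<partial>lborel) < \<infinity>"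
    and slow: "\<And>v. norm v \<le> M \<Longrightarrow> (\<integral>\<^sup>+x. ennreal ((\<phi> x - \<phi> (x + v))\<^sup>2) \<partial>lborel)
      \<le> ennreal (1 / (real N)\<^sup>2) * (\<integral>\<^sup>+x. ennreal ((\<phi> x)\<^sup>2) \<partial>lborel)"
    by (rule slowly_varying_bump) blast
  have [measurable]: "\<phi> \<in> borel_measurable borel"
    using cont by (rule borel_measurable_continuous_onI)
  let ?P = "\<integral>\<^sup>+x. ennreal ((\<phi> x)\<^sup>2) \<partial>lborel"
  define g where "g k x = \<phi> ((T ^^ k) x) / s ^ k" for k x
  define u where "u x = (\<Sum>k<N. g k x)" for x
  have g_meas [measurable]: "g k \<in> borel_measurable borel" for k
    unfolding g_def by simp
  have u_meas [measurable]: "u \<in> borel_measurable borel"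
    unfolding u_def by simp
  have g_nonneg: "0 \<le> g k x" for k x
    using nonneg s_pos by (simp add: g_def)
  have g_norm: "(\<integral>\<^sup>+x. ennreal ((g k x)\<^sup>2) \<partial>lborel) = ?P" for k
    unfolding g_def by (rule nn_integral_T_pow_square) simp
  let ?D = "\<integral>\<^sup>+x. ennreal ((u x)\<^sup>2) \<partial>lborel"
  have sum_g: "(\<integral>\<^sup>+x. ennreal (\<Sum>k<N. (g k x)\<^sup>2) \<partial>lborel) = ennreal (real N) * ?P"
    by (simp add: nn_integral_sum g_norm ennreal_of_nat_eq_real_of_nat flip: sum_ennreal)
  have D_ge: "ennreal (real N) * ?P \<le> ?D"
    unfolding sum_g[symmetric] u_def
    by (intro nn_integral_mono ennreal_leI sum_power2_le_power2_sum) (auto simp: g_nonneg)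
  \<comment> \<open>Only finiteness is wanted here, so the crude Cauchy-Schwarz factor
    suffices.\<close>
  have "?D \<le> (\<integral>\<^sup>+x. ennreal (real N) * ennreal (\<Sum>k<N. (g k x)\<^sup>2) \<partial>lborel)"
  proof (rule nn_integral_mono)
    fix x
    show "ennreal ((u x)\<^sup>2) \<le> ennreal (real N) * ennreal (\<Sum>k<N. (g k x)\<^sup>2)"
      using sum_squared_le_sum_of_squares[of "\<lambda>k. g k x" "{..<N}"]
      unfolding u_def by (subst ennreal_mult[symmetric]) (auto intro!: ennreal_leI sum_nonneg simp: mult.commute)
  qed
  also have "\<dots> = ennreal (real N) * (ennreal (real N) * ?P)"
    by (simp add: nn_integral_cmult sum_g)
  also have "\<dots> < \<infinity>"
    using fin by (simp add: ennreal_mult_less_top)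
  finally have D_fin: "?D < \<infinity>" .
  have "0 < ennreal (real N) * ?P"
    using N pos by (simp add: ennreal_zero_less_mult_iff)
  then have D_pos: "0 < ?D"
    using D_ge by (rule less_le_trans)
  obtain B where B: "0 < B" "\<And>k x. k < N \<Longrightarrow> norm x \<le> B * norm ((T ^^ k) x)"
    using T_pow_expand_bound[of N] by blast
  have u_supp: "u x = 0" if "B * L + 1 \<le> norm x" for x
  proof -
    have "g k x = 0" if "k < N" for k
    proof -
      have "B * L < B * norm ((T ^^ k) x)"
        using B(2)[OF that, of x] \<open>B * L + 1 \<le> norm x\<close> by linarith
      then show ?thesis
        using B(1) supp by (simp add: g_def)
    qed
    then show ?thesis
      by (simp add: u_def)
  qed
  have "(\<integral>\<^sup>+x. ennreal ((u x - u (T x + z) / s)\<^sup>2) \<partial>lborel) \<le> ennreal (9 / real N) * ?D"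
    if z: "norm z \<le> 1" for z
  proof -
    define h where "h k x = (\<phi> x - \<phi> (x + (T ^^ k) z))" for k x
    have [measurable]: "h k \<in> borel_measurable borel" for k
      unfolding h_def by simp
    \<comment> \<open>This is the change of \<open>g k\<close> caused by the offset
      \<open>z\<close>, which \<open>T ^^ k\<close> carries to \<open>(T ^^ k) z\<close>. The index
      \<open>Suc k\<close> accounts for the additional \<open>T\<close> and division by
      \<open>s\<close>.\<close>
    define e where "e k x = h k ((T ^^ Suc k) x) / s ^ Suc k" for k x
    have [measurable]: "e k \<in> borel_measurable borel" for k
      unfolding e_def by (simp del: funpow.simps power_Suc)
    have e_norm: "(\<integral>\<^sup>+x. ennreal ((e k x)\<^sup>2) \<partial>lborel) \<le> ennreal (1 / (real N)\<^sup>2) * ?P" if "k < N" for k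
    proof -
      have "(\<integral>\<^sup>+x. ennreal ((e k x)\<^sup>2) \<partial>lborel) = (\<integral>\<^sup>+x. ennreal ((h k x)\<^sup>2) \<partial>lborel)"
        unfolding e_def by (rule nn_integral_T_pow_square) simp
      also have "\<dots> \<le> ennreal (1 / (real N)\<^sup>2) * ?P"
        unfolding h_def using M[OF that z] by (rule slow)
      finally show ?thesis .
    qed
    have tele: "u x - u (T x + z) / s = g 0 x - g N x + (\<Sum>k<N. e k x)" for x
    proof -
      have "g k (T x + z) / s = g (Suc k) x - e k x" for k
      proof -
        have "(T ^^ k) (T x + z) = (T ^^ Suc k) x + (T ^^ k) z"
          using linear_add[OF linear_T_pow] by (simp add: funpow_swap1)
        then show ?thesis
          by (simp add: g_def e_def h_def diff_divide_distrib mult.commute)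
      qed
      then have "u (T x + z) / s = (\<Sum>k<N. g (Suc k) x) - (\<Sum>k<N. e k x)"
        by (simp add: u_def sum_divide_distrib sum_subtractf)
      moreover have "(\<Sum>k<N. g (Suc k) x) - u x = g N x - g 0 x"
        unfolding u_def sum_subtractf[symmetric] by (rule sum_lessThan_telescope)
      ultimately show ?thesis
        by linarith
    qed
    have "(\<integral>\<^sup>+x. ennreal ((u x - u (T x + z) / s)\<^sup>2) \<partial>lborel)
        \<le> (\<integral>\<^sup>+x. 3 * (ennreal ((g 0 x)\<^sup>2) + ennreal ((g N x)\<^sup>2) + ennreal (real N) * (\<Sum>k<N. ennreal ((e k x)\<^sup>2))) \<partial>lborel)"
    proof (rule nn_integral_mono)
      fix x
      let ?E = "\<Sum>k<N. e k x"
      \<comment> \<open>The difference of the two sides is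
        \<open>(p + q)^2 + (p - r)^2 + (q + r)^2\<close>.\<close>
      have sq: "(p - q + r)\<^sup>2 \<le> 3 * (p\<^sup>2 + q\<^sup>2 + r\<^sup>2)" for p q r :: real
        using sum_power2_ge_zero[of "p + q" "p - r"] zero_le_power2[of "q + r"]
        by (simp add: power2_eq_square algebra_simps)
      have "(u x - u (T x + z) / s)\<^sup>2 \<le> 3 * ((g 0 x)\<^sup>2 + (g N x)\<^sup>2 + ?E\<^sup>2)"
        unfolding tele by (rule sq)
      also have "\<dots> \<le> 3 * ((g 0 x)\<^sup>2 + (g N x)\<^sup>2 + real N * (\<Sum>k<N. (e k x)\<^sup>2))"
        using sum_squared_le_sum_of_squares[of "\<lambda>k. e k x" "{..<N}"] by (simp add: mult.commute)
      finally have "ennreal ((u x - u (T x + z) / s)\<^sup>2)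
          \<le> ennreal (3 * ((g 0 x)\<^sup>2 + (g N x)\<^sup>2 + real N * (\<Sum>k<N. (e k x)\<^sup>2)))"
        by (rule ennreal_leI)
      then show "ennreal ((u x - u (T x + z) / s)\<^sup>2)
          \<le> 3 * (ennreal ((g 0 x)\<^sup>2) + ennreal ((g N x)\<^sup>2) + ennreal (real N) * (\<Sum>k<N. ennreal ((e k x)\<^sup>2)))"
        by (simp add: ennreal_mult ennreal_plus sum_nonneg sum_ennreal)
    qed
    also have "\<dots> = 3 * (?P + ?P + ennreal (real N) * (\<Sum>k<N. \<integral>\<^sup>+x. ennreal ((e k x)\<^sup>2) \<partial>lborel))"
      by (simp add: nn_integral_add nn_integral_cmult nn_integral_sum g_norm del: sum_ennreal)
    also have "\<dots> \<le> 3 * (?P + ?P + ennreal (real N) * (\<Sum>k<N. ennreal (1 / (real N)\<^sup>2) * ?P))"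
      using e_norm by (intro mult_left_mono add_left_mono sum_mono) auto
    also have "ennreal (real N) * (\<Sum>k<N. ennreal (1 / (real N)\<^sup>2) * ?P) = ?P"
    proof -
      have "real N * (real N * (1 / (real N)\<^sup>2)) = 1"
        using N by (simp add: power2_eq_square)
      then have "ennreal (real N) * (ennreal (real N) * ennreal (1 / (real N)\<^sup>2)) = 1"
        by (metis ennreal_1 ennreal_mult' of_nat_0_le_iff)
      then show ?thesis
        by (simp add: ennreal_of_nat_eq_real_of_nat flip: mult.assoc)
    qed
    \<comment> \<open>The 9 is the factor 3 from \<open>sq\<close> times three terms;
      \<open>N * ?P\<close> is split off so that \<open>D_ge\<close> applies.\<close>
    also have "3 * (?P + ?P + ?P) = ennreal (9 / real N) * (ennreal (real N) * ?P)"
    proof -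
      have "ennreal (9 / real N) * ennreal (real N) = 9"
        using N by (simp flip: ennreal_mult)
      moreover have "?P + ?P + ?P = 3 * ?P"
        using distrib_right[of 2 1 ?P] by (simp add: mult_2)
      ultimately show ?thesis
        by (simp flip: mult.assoc)
    qed
    also have "\<dots> \<le> ennreal (9 / real N) * ?D"
      using D_ge by (rule mult_left_mono) simp
    finally show ?thesis .
  qed
  with u_meas u_supp D_pos D_fin show ?thesis
    by (rule that)
qed

subsection \<open>Bounds on the first eigenvalue\<close>

text \<open>Divide \<open>energy_ge\<close> by the square norm, which is positive and finite for an
  admissible function. As zero extension preserves this norm, the bound is the same for every
  measurable domain.\<close>

lemma lambda1_ge:
  assumes nonneg: "\<And>z. 0 \<le> \<psi> z" and \<psi>: "\<psi> \<in> borel_measurable lebesgue"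
    and m: "(\<integral>\<^sup>+z. ennreal (\<psi> z) \<partial>lborel) = ennreal m" and "0 \<le> m"
    and \<Omega>: "\<Omega> \<in> sets lebesgue"
  shows "ennreal (2 * (1 - s)\<^sup>2 * m) \<le> lambda1 (\<lambda>x y. \<psi> (y - T x) + \<psi> (x - T y)) \<Omega>"
  unfolding lambda1_def
proof (rule INF_greatest)
  fix u assume "u \<in> L2_nonzero \<Omega>"
  then have u: "u \<in> borel_measurable (lebesgue_on \<Omega>)" "integrable (lebesgue_on \<Omega>) (\<lambda>x. (u x)\<^sup>2)"
      "\<not> (AE x in lebesgue_on \<Omega>. u x = 0)"
    by (auto simp: L2_nonzero_def)
  let ?w = "zero_ext \<Omega> u" and ?D = "\<integral>\<^sup>+x. ennreal ((u x)\<^sup>2) \<partial>lebesgue_on \<Omega>"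
  have w: "?w \<in> borel_measurable lebesgue"
  proof -
    have "(\<lambda>x. indicator \<Omega> x *\<^sub>R u x) \<in> borel_measurable lebesgue"
      using u(1) \<Omega> by (subst borel_measurable_restrict_space_iff[symmetric]) auto
    moreover have "?w = (\<lambda>x. indicator \<Omega> x *\<^sub>R u x)"
      by (auto simp: zero_ext_def fun_eq_iff)
    ultimately show ?thesis
      by simp
  qed
  have D_eq: "?D = (\<integral>\<^sup>+x. ennreal ((?w x)\<^sup>2) \<partial>lborel)"
    using \<Omega> by (subst nn_integral_restrict_space)
      (auto simp: zero_ext_def nn_integral_completion indicator_def intro!: nn_integral_cong)
  have "?D = ennreal (\<integral>x. (u x)\<^sup>2 \<partial>lebesgue_on \<Omega>)"
    using u(2) by (intro nn_integral_eq_integral) auto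
  then have D_fin: "?D < top"
    by simp
  have D_pos: "?D \<noteq> 0"
    using u(1,3) by (subst nn_integral_0_iff_AE) auto
  have "ennreal (2 * (1 - s)\<^sup>2 * m) * ?D = 2 * (ennreal ((1 - s)\<^sup>2) * ?D * ennreal m)"
    using \<open>0 \<le> m\<close> by (simp add: ennreal_mult mult_ac)
  also have "\<dots> \<le> energy \<psi> ?w"
    using energy_ge[OF nonneg \<psi> w] D_fin unfolding D_eq m by simp
  finally have "ennreal (2 * (1 - s)\<^sup>2 * m) \<le> energy \<psi> ?w / ?D"
    using divide_right_mono_ennreal[of "ennreal (2 * (1 - s)\<^sup>2 * m) * ?D" "energy \<psi> ?w" ?D] D_pos D_fin
    by (simp add: mult_divide_eq_ennreal)
  then show "ennreal (2 * (1 - s)\<^sup>2 * m) \<le>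
      (\<integral>\<^sup>+y. (\<integral>\<^sup>+x. ennreal ((\<psi> (y - T x) + \<psi> (x - T y)) * (?w x - ?w y)\<^sup>2) \<partial>lebesgue) \<partial>lebesgue) / ?D"
    by (simp only: energy_def)
qed

text \<open>A single test function supported in a ball is admissible for every domain containing
  that ball, so one \<open>R\<close> serves all larger balls and the whole space.\<close>

lemma lambda1_le:
  assumes nonneg: "\<And>z. 0 \<le> \<psi> z" and \<psi>: "\<psi> \<in> borel_measurable lebesgue"
    and supp: "{z. \<psi> z \<noteq> 0} \<subseteq> cball 0 1"
    and m: "(\<integral>\<^sup>+z. ennreal (\<psi> z) \<partial>lborel) = ennreal m" and "0 \<le> m"
    and "0 < \<epsilon>"
  obtains R where "\<And>\<Omega>. \<Omega> \<in> sets lebesgue \<Longrightarrow> ball 0 R \<subseteq> \<Omega> \<Longrightarrow>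
    lambda1 (\<lambda>x y. \<psi> (y - T x) + \<psi> (x - T y)) \<Omega> \<le> ennreal (2 * (1 - s)\<^sup>2 * m + \<epsilon>)"
proof -
  \<comment> \<open>Almost invariance with constant \<open>9 / N\<close> adds
    \<open>2 * s * (9 / N) * m\<close> to the quotient; this choice of \<open>N\<close> keeps it
    below \<open>\<epsilon>\<close>.\<close>
  obtain N where N: "18 * s * m / \<epsilon> < real N"
    using reals_Archimedean2 by blast
  have "0 \<le> 18 * s * m / \<epsilon>"
    using assms s_pos by simp
  then have "0 < N"
    using N by linarith
  obtain u R where u: "u \<in> borel_measurable borel" and u_supp: "\<And>x. R \<le> norm x \<Longrightarrow> u x = 0"
    and pos: "0 < (\<integral>\<^sup>+x. ennreal ((u x)\<^sup>2) \<partial>lborel)" and fin: "(\<integral>\<^sup>+x. ennreal ((u x)\<^sup>2) \<partial>lborel) < \<infinity>"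
    and inv: "\<And>z. norm z \<le> 1 \<Longrightarrow>
      (\<integral>\<^sup>+x. ennreal ((u x - u (T x + z) / s)\<^sup>2) \<partial>lborel) \<le> ennreal (9 / real N) * (\<integral>\<^sup>+x. ennreal ((u x)\<^sup>2) \<partial>lborel)"
    by (rule almost_invariant_function[OF \<open>0 < N\<close>]) blast
  let ?D = "\<integral>\<^sup>+x. ennreal ((u x)\<^sup>2) \<partial>lborel"
  have "energy \<psi> u \<le> 2 * (ennreal ((1 - s)\<^sup>2) * ?D + ennreal s * (ennreal (9 / real N) * ?D)) * ennreal m"
    using energy_le[OF nonneg \<psi> supp u fin inv] unfolding m .
  also have "\<dots> = ennreal (2 * (1 - s)\<^sup>2 * m + 18 * s * m / real N) * ?D"
  proof -
    have "2 * (ennreal ((1 - s)\<^sup>2) * ?D + ennreal s * (ennreal (9 / real N) * ?D)) * ennreal m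
        = (2 * (ennreal ((1 - s)\<^sup>2) + ennreal s * ennreal (9 / real N)) * ennreal m) * ?D"
      by (simp add: algebra_simps)
    also have "2 * (ennreal ((1 - s)\<^sup>2) + ennreal s * ennreal (9 / real N)) * ennreal m
        = ennreal (2 * ((1 - s)\<^sup>2 + s * (9 / real N)) * m)"
    proof -
      define t where "t = (1 - s)\<^sup>2 + s * (9 / real N)"
      have "0 \<le> t" and t: "ennreal t = ennreal ((1 - s)\<^sup>2) + ennreal s * ennreal (9 / real N)"
        using s_pos by (simp_all add: t_def ennreal_mult del: times_divide_eq_right)
      then show ?thesis
        unfolding t_def[symmetric] t[symmetric] using \<open>0 \<le> m\<close> by (simp add: ennreal_mult)
    qed
    also have "2 * ((1 - s)\<^sup>2 + s * (9 / real N)) * m = 2 * (1 - s)\<^sup>2 * m + 18 * s * m / real N"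
      by (simp add: algebra_simps)
    finally show ?thesis .
  qed
  also have "\<dots> \<le> ennreal (2 * (1 - s)\<^sup>2 * m + \<epsilon>) * ?D"
  proof (intro mult_right_mono ennreal_leI)
    have "18 * s * m / real N \<le> \<epsilon>"
      using N \<open>0 < N\<close> \<open>0 < \<epsilon>\<close> by (simp add: field_simps)
    then show "2 * (1 - s)\<^sup>2 * m + 18 * s * m / real N \<le> 2 * (1 - s)\<^sup>2 * m + \<epsilon>"
      by simp
  qed simp
  finally have E: "energy \<psi> u / ?D \<le> ennreal (2 * (1 - s)\<^sup>2 * m + \<epsilon>)"
    unfolding mult.commute[of _ ?D] by (rule divide_le_posI_ennreal[OF pos])
  show ?thesis
  proof (rule that)
    fix \<Omega> :: "'a set"
    assume \<Omega>: "\<Omega> \<in> sets lebesgue" and "ball 0 R \<subseteq> \<Omega>"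
    then have out: "u x = 0" if "x \<notin> \<Omega>" for x
      using that u_supp[of x] by force
    then have ext: "zero_ext \<Omega> u = u"
      by (auto simp: zero_ext_def)
    have D_eq: "(\<integral>\<^sup>+x. ennreal ((u x)\<^sup>2) \<partial>lebesgue_on \<Omega>) = ?D"
      using \<Omega> out by (subst nn_integral_restrict_space)
        (auto simp: nn_integral_completion indicator_def intro!: nn_integral_cong)
    have u_meas: "u \<in> borel_measurable (lebesgue_on \<Omega>)"
      using u by (intro measurable_restrict_space1 measurable_completion) simp
    have "integrable (lebesgue_on \<Omega>) (\<lambda>x. (u x)\<^sup>2)"
      using u_meas fin D_eq by (intro integrableI_bounded) auto
    moreover have "\<not> (AE x in lebesgue_on \<Omega>. u x = 0)"
    proof
      assume "AE x in lebesgue_on \<Omega>. u x = 0"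
      then have "(\<integral>\<^sup>+x. ennreal ((u x)\<^sup>2) \<partial>lebesgue_on \<Omega>) = (\<integral>\<^sup>+x. 0 \<partial>lebesgue_on \<Omega>)"
        by (intro nn_integral_cong_AE) auto
      then show False
        using D_eq pos by simp
    qed
    ultimately have "u \<in> L2_nonzero \<Omega>"
      using u_meas by (simp add: L2_nonzero_def)
    then have "lambda1 (\<lambda>x y. \<psi> (y - T x) + \<psi> (x - T y)) \<Omega> \<le> energy \<psi> u / ?D"
      unfolding lambda1_def by (rule INF_lower2) (simp add: ext D_eq energy_def)
    then show "lambda1 (\<lambda>x y. \<psi> (y - T x) + \<psi> (x - T y)) \<Omega> \<le> ennreal (2 * (1 - s)\<^sup>2 * m + \<epsilon>)"
      using E by (rule order_trans)
  qed
qed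

end

section \<open>Specialisation to an invertible matrix and the limit of large balls\<close>

lemma scaling_map_matrix:
  fixes A :: "real^'n^'n"
  assumes "invertible A"
  shows "scaling_map ((*v) A) (\<bar>det A\<bar> powr (- 1 / 2))"
proof (rule scaling_map.intro)
  have d: "det A \<noteq> 0"
    using assms by (simp add: invertible_det_nz)
  have "(\<bar>det A\<bar> powr (- 1 / 2))\<^sup>2 = \<bar>det A\<bar> powr - 1"
    by (simp add: power2_eq_square flip: powr_add)
  \<comment> \<open>Composition with the matrix divides integrals by
    \<open>\<bar>det A\<bar>\<close>, so \<open>nn_integral_T\<close> forces \<open>s^2\<close> to
    be its reciprocal.\<close>
  then have s2: "(\<bar>det A\<bar> powr (- 1 / 2))\<^sup>2 * \<bar>det A\<bar> = 1"
    using d by (simp add: powr_minus)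
  show "linear ((*v) A)"
    by (rule matrix_vector_mul_linear)
  show "inj ((*v) A)"
    using assms by (simp add: inj_matrix_vector_mult)
  show "0 < \<bar>det A\<bar> powr (- 1 / 2)"
    using d by simp
  fix f :: "real^'n \<Rightarrow> ennreal" assume "f \<in> borel_measurable borel"
  then have f: "(\<integral>\<^sup>+x. f x \<partial>lborel) = ennreal \<bar>det A\<bar> * (\<integral>\<^sup>+x. f (A *v x) \<partial>lborel)"
    using nn_integral_lborel_linear[of "(*v) A" f] d by (simp add: matrix_vector_mul_linear)
  have "ennreal ((\<bar>det A\<bar> powr (- 1 / 2))\<^sup>2) * ennreal \<bar>det A\<bar> = 1"
    using s2 by (simp flip: ennreal_mult)
  then show "(\<integral>\<^sup>+x. f (A *v x) \<partial>lborel) = ennreal ((\<bar>det A\<bar> powr (- 1 / 2))\<^sup>2) * (\<integral>\<^sup>+x. f x \<partial>lborel)"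
    by (simp only: f mult.assoc[symmetric] mult_1_left)
qed

theorem theorem1p4:
  fixes \<psi> :: "real^'n \<Rightarrow> real" and A :: "real^'n^'n"
  assumes psi_nonneg: "\<And>x. 0 \<le> \<psi> x"
    and psi_bounded: "bounded (range \<psi>)"
    and psi_measurable: "\<psi> \<in> borel_measurable lebesgue"
    and psi_support: "{x. \<psi> x \<noteq> 0} \<subseteq> cball 0 1"
    and A_invertible: "invertible A"
  shows "((\<lambda>R::real. lambda1 (jump_kernel \<psi> A) (ball 0 R)) \<longlongrightarrow> lambda1 (jump_kernel \<psi> A) UNIV) at_top
    \<and> lambda1 (jump_kernel \<psi> A) UNIV =
        ennreal (2 * (1 - \<bar>det A\<bar> powr (- 1 / 2))\<^sup>2 * (\<integral>x. \<psi> x \<partial>lebesgue))"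
proof -
  interpret scaling_map "(*v) A" "\<bar>det A\<bar> powr (- 1 / 2)"
    using A_invertible by (rule scaling_map_matrix)
  let ?K = "jump_kernel \<psi> A"
  have K: "(\<lambda>x y. \<psi> (y - A *v x) + \<psi> (x - A *v y)) = ?K"
    by (simp add: jump_kernel_def fun_eq_iff)
  define m where "m = (\<integral>x. \<psi> x \<partial>lebesgue)"
  define c where "c = 2 * (1 - \<bar>det A\<bar> powr (- 1 / 2))\<^sup>2 * m"
  obtain b where b: "\<And>x. \<bar>\<psi> x\<bar> \<le> b"
    using psi_bounded by (auto simp: bounded_iff)
  \<comment> \<open>Boundedness and the support condition dominate \<open>\<psi>\<close> by a
    multiple of the indicator of the unit ball; its integral in [0,\<infinity>] is therefore the
    real number \<open>m\<close>.\<close>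
  have "integrable lebesgue \<psi>"
  proof (rule Bochner_Integration.integrable_bound)
    have "integrable lebesgue (indicat_real (cball (0 :: real^'n) 1))"
      using lmeasurable_cball[of "0 :: real^'n" 1] by (simp add: fmeasurable_def)
    then show "integrable lebesgue (\<lambda>x. b * indicat_real (cball (0 :: real^'n) 1) x)"
      by (rule integrable_mult_right)
    show "AE x in lebesgue. norm (\<psi> x) \<le> norm (b * indicat_real (cball 0 1) x)"
    proof (rule AE_I2)
      fix x
      show "norm (\<psi> x) \<le> norm (b * indicat_real (cball 0 1) x)"
        using psi_support b[of x] by (cases "\<psi> x = 0") auto
    qed
  qed (rule psi_measurable)
  then have "(\<integral>\<^sup>+z. ennreal (\<psi> z) \<partial>lebesgue) = ennreal m"
    unfolding m_def by (intro nn_integral_eq_integral) (auto simp: psi_nonneg)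
  then have m: "(\<integral>\<^sup>+z. ennreal (\<psi> z) \<partial>lborel) = ennreal m"
    by (simp only: nn_integral_completion)
  have "0 \<le> m"
    unfolding m_def by (simp add: psi_nonneg)
  have "0 \<le> c"
    using \<open>0 \<le> m\<close> by (simp add: c_def)
  have ge: "ennreal c \<le> lambda1 ?K \<Omega>" if "\<Omega> \<in> sets lebesgue" for \<Omega>
    using lambda1_ge[OF psi_nonneg psi_measurable m \<open>0 \<le> m\<close> that] unfolding K c_def .
  have le: "\<exists>R. \<forall>\<Omega>\<in>sets lebesgue. ball 0 R \<subseteq> \<Omega> \<longrightarrow> lambda1 ?K \<Omega> \<le> ennreal (c + \<epsilon>)" if "0 < \<epsilon>" for \<epsilon>
    by (rule lambda1_le[OF psi_nonneg psi_measurable psi_support m \<open>0 \<le> m\<close> that, unfolded K, folded c_def]) blast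
  have UNIV: "lambda1 ?K UNIV = ennreal c"
  proof (rule antisym)
    show "lambda1 ?K UNIV \<le> ennreal c"
    proof (rule ennreal_le_epsilon)
      fix \<epsilon> :: real assume "0 < \<epsilon>"
      then show "lambda1 ?K UNIV \<le> ennreal c + ennreal \<epsilon>"
        using le[of \<epsilon>] \<open>0 \<le> c\<close> by auto
    qed
  qed (simp add: ge)
  have "((\<lambda>R. lambda1 ?K (ball 0 R)) \<longlongrightarrow> ennreal c) at_top"
  proof (rule order_tendstoI)
    fix a assume "a < ennreal c"
    then have "a < lambda1 ?K (ball 0 R)" for R
      using ge[of "ball 0 R"] by (rule less_le_trans) simp
    then show "\<forall>\<^sub>F R in at_top. a < lambda1 ?K (ball 0 R)"
      by simp
  next
    fix a assume "ennreal c < a"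
    \<comment> \<open>The intermediate value is finite even if \<open>a\<close> is infinite, and it
      turns the non-strict upper bound into the strict one required for the limit.\<close>
    then obtain a' where a': "ennreal c < a'" "a' < a"
      using dense by blast
    then obtain r where r: "a' = ennreal r" "0 \<le> r"
      by (cases a' rule: ennreal_cases) auto
    then have "0 < r - c"
      using a'(1) \<open>0 \<le> c\<close> by (simp add: ennreal_less_iff)
    then obtain R0 where R0: "\<And>\<Omega>. \<Omega> \<in> sets lebesgue \<Longrightarrow> ball 0 R0 \<subseteq> \<Omega> \<Longrightarrow> lambda1 ?K \<Omega> \<le> a'"
      using le[of "r - c"] r by auto
    show "\<forall>\<^sub>F R in at_top. lambda1 ?K (ball 0 R) < a"
      using eventually_ge_at_top[of R0]
    proof eventually_elim
      case (elim R)
      then have "lambda1 ?K (ball 0 R) \<le> a'"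
        by (intro R0) auto
      then show ?case
        using a'(2) by (rule le_less_trans)
    qed
  qed
  then show ?thesis
    unfolding UNIV by (simp add: c_def m_def)
qed

end
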